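(* Let $(R,\mathfrak m)$ be a commutative noetherian local ring, let $I$ be an ideal of $R$, let $X$ be an arbitrary $R$-module and let $M\subset X$ be a submodule. Then $M$ is strongly $I$-small in $X$ if and only if $M$ is $I$-small in $X$ and $IM$ is small in $M$.
   Context: For a submodule $W$ of $X$, write $W:I=W:_X I=\{x\in X\mid Ix\subset W\}$, and for an $R$-module $N$ write $N[I]=\{y\in N\mid Iy=0\}$. $M$ is called $I$-small in $X$ if there is a module $X'$ with $M\subset X'\subset X$ and $M=IX'$; equivalently, $M=I(M:_X I)$. $M$ is called strongly $I$-small in $X$ if for every submodule $U$ of $M$: whenever the canonical map $(X/U)[I]\to (X/M)[I]$ is surjective (i.e. $(U:I)+M=M:I$), then $U=M$. A submodule $V$ of $M$ is called small in $M$ if $U+V=M$ with $U\subset M$ a submodule always implies $U=M$. *)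

theory Defs
  imports "HOL-Algebra.Module" "HOL-Algebra.Ring_Divisibility"
begin

locale local_ring = cring R + maximalideal \<mm> R for R (structure) and \<mm> +
  assumes maximalideal_unique: "maximalideal J R \<Longrightarrow> J = \<mm>"

locale noetherian_local_ring = local_ring R \<mm> + noetherian_ring R for R (structure) and \<mm>

text \<open>All submodules are represented as subsets of the carrier of one ambient module \<open>X\<close>;
  a submodule of a submodule \<open>M\<close> of \<open>X\<close> is a submodule of \<open>X\<close> contained in \<open>M\<close>.\<close>

text \<open>The product \<open>I N\<close>, i.e. all finite nonempty sums of products. It is a submodule,
  in particular contains zero, as soon as \<open>I\<close> is an ideal and \<open>N\<close> a submodule.\<close>

inductive_set ideal_smult :: "('a, 'b, 'm) module_scheme \<Rightarrow> 'a set \<Rightarrow> 'b set \<Rightarrow> 'b set"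
  for X and I and N where
    prod: "\<lbrakk>i \<in> I; x \<in> N\<rbrakk> \<Longrightarrow> i \<odot>\<^bsub>X\<^esub> x \<in> ideal_smult X I N"
  | sum: "\<lbrakk>s \<in> ideal_smult X I N; t \<in> ideal_smult X I N\<rbrakk> \<Longrightarrow> s \<oplus>\<^bsub>X\<^esub> t \<in> ideal_smult X I N"

definition colon :: "('a, 'b, 'm) module_scheme \<Rightarrow> 'b set \<Rightarrow> 'a set \<Rightarrow> 'b set" where
  "colon X W I = {x \<in> carrier X. \<forall>i\<in>I. i \<odot>\<^bsub>X\<^esub> x \<in> W}"

definition annihilated :: "('a, 'b, 'm) module_scheme \<Rightarrow> 'a set \<Rightarrow> 'b set" where
  "annihilated N I = {y \<in> carrier N. \<forall>i\<in>I. i \<odot>\<^bsub>N\<^esub> y = \<zero>\<^bsub>N\<^esub>}"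

text \<open>The fields \<^const>\<open>monoid.mult\<close> and \<^const>\<open>monoid.one\<close> of the record are irrelevant for modules.\<close>

definition quot_module :: "('a, 'b, 'm) module_scheme \<Rightarrow> 'b set \<Rightarrow> ('a, 'b set) module" where
  "quot_module X U =
    \<lparr>carrier = a_rcosets\<^bsub>X\<^esub> U, mult = undefined, one = undefined, zero = U, add = set_add X,
     smult = (\<lambda>r A. \<Union>x\<in>A. U +>\<^bsub>X\<^esub> (r \<odot>\<^bsub>X\<^esub> x))\<rparr>"

text \<open>The map \<open>X/U \<rightarrow> X/M\<close>, \<open>U + x \<mapsto> M + x\<close>, for \<open>U \<subseteq> M\<close>; see \<open>quot_map_coset\<close> below.\<close>

definition quot_map :: "('a, 'b, 'm) module_scheme \<Rightarrow> 'b set \<Rightarrow> 'b set \<Rightarrow> 'b set" where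
  "quot_map X M A = (\<Union>x\<in>A. M +>\<^bsub>X\<^esub> x)"

definition ideal_small ::
    "('a, 'r) ring_scheme \<Rightarrow> 'a set \<Rightarrow> ('a, 'b, 'm) module_scheme \<Rightarrow> 'b set \<Rightarrow> bool" where
  "ideal_small R I X M \<longleftrightarrow> (\<exists>X'. submodule X' R X \<and> M \<subseteq> X' \<and> M = ideal_smult X I X')"

definition strongly_ideal_small ::
    "('a, 'r) ring_scheme \<Rightarrow> 'a set \<Rightarrow> ('a, 'b, 'm) module_scheme \<Rightarrow> 'b set \<Rightarrow> bool" where
  "strongly_ideal_small R I X M \<longleftrightarrow>
    (\<forall>U. submodule U R X \<and> U \<subseteq> M \<and>
         quot_map X M ` annihilated (quot_module X U) I = annihilated (quot_module X M) I
         \<longrightarrow> U = M)"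

definition small_in ::
    "('a, 'r) ring_scheme \<Rightarrow> ('a, 'b, 'm) module_scheme \<Rightarrow> 'b set \<Rightarrow> 'b set \<Rightarrow> bool" where
  "small_in R X V M \<longleftrightarrow> submodule V R X \<and> V \<subseteq> M \<and>
    (\<forall>U. submodule U R X \<and> U \<subseteq> M \<and> U <+>\<^bsub>X\<^esub> V = M \<longrightarrow> U = M)"


subsection \<open>Basic facts on the definitions\<close>

lemma (in module) submodule_abelian_subgroup:
  assumes "submodule U R M" shows "abelian_subgroup U M"
  using assms M.abelian_group_axioms
  by (simp add: abelian_subgroupI3 additive_subgroup.intro submodule.axioms(1))

lemma (in module) smult_coset:
  assumes U: "submodule U R M" and r: "r \<in> carrier R" and x: "x \<in> carrier M"
  shows "r \<odot>\<^bsub>quot_module M U\<^esub> (U +>\<^bsub>M\<^esub> x) = U +>\<^bsub>M\<^esub> (r \<odot>\<^bsub>M\<^esub> x)"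
proof -
  interpret U: abelian_subgroup U M by (rule submodule_abelian_subgroup[OF U])
  have eq: "U +>\<^bsub>M\<^esub> (r \<odot>\<^bsub>M\<^esub> y) = U +>\<^bsub>M\<^esub> (r \<odot>\<^bsub>M\<^esub> x)" if y: "y \<in> U +>\<^bsub>M\<^esub> x" for y
  proof -
    obtain u where u: "u \<in> U" "y = u \<oplus>\<^bsub>M\<^esub> x"
      using y by (auto simp: a_r_coset_def r_coset_def)
    have uc: "u \<in> carrier M" using u U.a_Hcarr by simp
    have ru: "r \<odot>\<^bsub>M\<^esub> u \<in> U" using submoduleE(4)[OF U r u(1)] .
    have "r \<odot>\<^bsub>M\<^esub> y = r \<odot>\<^bsub>M\<^esub> u \<oplus>\<^bsub>M\<^esub> r \<odot>\<^bsub>M\<^esub> x" using u uc r x by (simp add: smult_r_distr)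
    then have "r \<odot>\<^bsub>M\<^esub> y \<in> U +>\<^bsub>M\<^esub> (r \<odot>\<^bsub>M\<^esub> x)"
      using ru by (auto simp: a_r_coset_def r_coset_def)
    then show ?thesis
      using U.a_repr_independence'[symmetric] r x by blast
  qed
  have "(\<Union>y\<in>U +>\<^bsub>M\<^esub> x. U +>\<^bsub>M\<^esub> (r \<odot>\<^bsub>M\<^esub> y)) = (\<Union>y\<in>U +>\<^bsub>M\<^esub> x. U +>\<^bsub>M\<^esub> (r \<odot>\<^bsub>M\<^esub> x))"
    by (rule SUP_cong[OF refl eq])
  also have "\<dots> = U +>\<^bsub>M\<^esub> (r \<odot>\<^bsub>M\<^esub> x)" using U.a_rcos_self[OF x] by blast
  finally show ?thesis by (simp add: quot_module_def)
qed

lemma (in module) carrier_quot_module: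
  "carrier (quot_module M U) = (\<lambda>x. U +>\<^bsub>M\<^esub> x) ` carrier M"
  by (auto simp: quot_module_def A_RCOSETS_defs a_r_coset_def r_coset_def)

lemma (in module) quot_module_module:
  assumes U: "submodule U R M"
  shows "module R (quot_module M U)"
proof -
  interpret U: abelian_subgroup U M by (rule submodule_abelian_subgroup[OF U])
  have add: "(U +>\<^bsub>M\<^esub> x) \<oplus>\<^bsub>quot_module M U\<^esub> (U +>\<^bsub>M\<^esub> y) = U +>\<^bsub>M\<^esub> (x \<oplus>\<^bsub>M\<^esub> y)"
    if "x \<in> carrier M" "y \<in> carrier M" for x y
    using that by (simp add: quot_module_def U.a_rcos_sum)
  have zero: "\<zero>\<^bsub>quot_module M U\<^esub> = U +>\<^bsub>M\<^esub> \<zero>\<^bsub>M\<^esub>"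
    by (simp add: quot_module_def U.a_rcos_const U.zero_closed)
  have "\<exists>y\<in>carrier M. U +>\<^bsub>M\<^esub> (y \<oplus>\<^bsub>M\<^esub> x) = U +>\<^bsub>M\<^esub> \<zero>\<^bsub>M\<^esub>" if "x \<in> carrier M" for x
    using that by (intro bexI[of _ "\<ominus>\<^bsub>M\<^esub> x"]) (simp_all add: M.l_neg)
  then have ag: "abelian_group (quot_module M U)"
    by (intro abelian_groupI; unfold carrier_quot_module zero)
      (auto simp: add M.a_assoc, simp_all add: M.a_comm)
  show ?thesis
    by (rule moduleI)
      (auto simp: carrier_quot_module smult_coset[OF U] add smult_l_distr smult_r_distr
        smult_assoc1 ag is_cring)
qed

lemma (in module) quot_map_coset:
  assumes U: "submodule U R M" and N: "submodule N R M" and UN: "U \<subseteq> N" and x: "x \<in> carrier M"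
  shows "quot_map M N (U +>\<^bsub>M\<^esub> x) = N +>\<^bsub>M\<^esub> x"
proof -
  interpret U: abelian_subgroup U M by (rule submodule_abelian_subgroup[OF U])
  interpret N: abelian_subgroup N M by (rule submodule_abelian_subgroup[OF N])
  have "y \<in> N +>\<^bsub>M\<^esub> x" if "y \<in> U +>\<^bsub>M\<^esub> x" for y
    using that UN by (auto simp: a_r_coset_def r_coset_def)
  then have eq: "N +>\<^bsub>M\<^esub> y = N +>\<^bsub>M\<^esub> x" if "y \<in> U +>\<^bsub>M\<^esub> x" for y
    using N.a_repr_independence'[OF _ x, symmetric] that by blast
  have "quot_map M N (U +>\<^bsub>M\<^esub> x) = (\<Union>y\<in>U +>\<^bsub>M\<^esub> x. N +>\<^bsub>M\<^esub> x)"
    unfolding quot_map_def by (rule SUP_cong[OF refl eq])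
  then show ?thesis using U.a_rcos_self[OF x] by blast
qed

lemma (in module) annihilated_quot_module:
  assumes I: "ideal I R" and U: "submodule U R M"
  shows "annihilated (quot_module M U) I = (\<lambda>x. U +>\<^bsub>M\<^esub> x) ` colon M U I"
proof -
  interpret U: abelian_subgroup U M by (rule submodule_abelian_subgroup[OF U])
  have Ic: "i \<in> carrier R" if "i \<in> I" for i using ideal.Icarr[OF I that] .
  have z: "\<zero>\<^bsub>quot_module M U\<^esub> = U" by (simp add: quot_module_def)
  have "U +>\<^bsub>M\<^esub> y = U \<longleftrightarrow> y \<in> U" if "y \<in> carrier M" for y
    using that U.a_rcos_const U.a_rcos_self[of y] by auto
  then have "(\<forall>i\<in>I. i \<odot>\<^bsub>quot_module M U\<^esub> (U +>\<^bsub>M\<^esub> x) = \<zero>\<^bsub>quot_module M U\<^esub>)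
      \<longleftrightarrow> (\<forall>i\<in>I. i \<odot>\<^bsub>M\<^esub> x \<in> U)" if "x \<in> carrier M" for x
    using that Ic by (simp add: z smult_coset[OF U])
  then show ?thesis
    unfolding annihilated_def colon_def carrier_quot_module by blast
qed

lemma (in module) quot_map_surj_iff:
  assumes I: "ideal I R" and U: "submodule U R M" and N: "submodule N R M" and UN: "U \<subseteq> N"
  shows "quot_map M N ` annihilated (quot_module M U) I = annihilated (quot_module M N) I
    \<longleftrightarrow> colon M U I <+>\<^bsub>M\<^esub> N = colon M N I"
proof -
  interpret N: abelian_subgroup N M by (rule submodule_abelian_subgroup[OF N])
  have Ic: "i \<in> carrier R" if "i \<in> I" for i using ideal.Icarr[OF I that] .
  have cU: "x \<in> carrier M" if "x \<in> colon M W I" for x W using that by (simp add: colon_def)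
  have NN: "n \<oplus>\<^bsub>M\<^esub> x \<in> colon M N I" if "n \<in> N" "x \<in> colon M N I" for n x
    using that submoduleE(4,5)[OF N] N.a_Hcarr Ic by (auto simp: colon_def smult_r_distr)
  have mono: "colon M U I \<subseteq> colon M N I" using UN by (auto simp: colon_def)
  have "quot_map M N ` annihilated (quot_module M U) I = (\<lambda>x. N +>\<^bsub>M\<^esub> x) ` colon M U I"
    unfolding annihilated_quot_module[OF I U] image_image
    using quot_map_coset[OF U N UN] cU by (intro image_cong) auto
  moreover have "(\<lambda>x. N +>\<^bsub>M\<^esub> x) ` colon M U I = (\<lambda>x. N +>\<^bsub>M\<^esub> x) ` colon M N I
      \<longleftrightarrow> colon M U I <+>\<^bsub>M\<^esub> N = colon M N I" (is "?L \<longleftrightarrow> ?R")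
  proof
    assume L: ?L
    show ?R
    proof
      show "colon M U I <+>\<^bsub>M\<^esub> N \<subseteq> colon M N I"
        using NN mono cU N.a_Hcarr by (fastforce simp: set_add_def set_mult_def M.a_comm)
      show "colon M N I \<subseteq> colon M U I <+>\<^bsub>M\<^esub> N"
      proof
        fix x assume x: "x \<in> colon M N I"
        then obtain y where y: "y \<in> colon M U I" "N +>\<^bsub>M\<^esub> x = N +>\<^bsub>M\<^esub> y" using L by blast
        have "x \<in> N +>\<^bsub>M\<^esub> y" using N.a_rcos_self[OF cU[OF x]] y by simp
        then obtain n where n: "n \<in> N" "x = n \<oplus>\<^bsub>M\<^esub> y" by (auto simp: a_r_coset_def r_coset_def)
        then have "x = y \<oplus>\<^bsub>M\<^esub> n" using M.a_comm[OF N.a_Hcarr[OF n(1)] cU[OF y(1)]] by simp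
        then show "x \<in> colon M U I <+>\<^bsub>M\<^esub> N"
          using y n by (auto simp: set_add_def set_mult_def)
      qed
    qed
  next
    assume R: ?R
    have "N +>\<^bsub>M\<^esub> x \<in> (\<lambda>x. N +>\<^bsub>M\<^esub> x) ` colon M U I" if x: "x \<in> colon M N I" for x
    proof -
      obtain y n where yn: "y \<in> colon M U I" "n \<in> N" "x = y \<oplus>\<^bsub>M\<^esub> n"
        using x R[symmetric] by (auto simp: set_add_def set_mult_def)
      then have "x \<in> N +>\<^bsub>M\<^esub> y"
        using M.a_comm[OF N.a_Hcarr[OF yn(2)] cU[OF yn(1)]]
        by (auto simp: a_r_coset_def r_coset_def intro!: bexI[of _ n])
      then have "N +>\<^bsub>M\<^esub> x = N +>\<^bsub>M\<^esub> y"
        using N.a_repr_independence'[symmetric] cU yn by blast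
      then show ?thesis using yn by blast
    qed
    then show ?L using mono by blast
  qed
  ultimately show ?thesis by (simp add: annihilated_quot_module[OF I N])
qed

lemma (in module) ideal_smult_submodule:
  assumes I: "ideal I R" and N: "submodule N R M"
  shows "submodule (ideal_smult M I N) R M"
proof -
  interpret I: ideal I R by (rule I)
  have Nc: "x \<in> carrier M" if "x \<in> N" for x using that submoduleE(1)[OF N] by blast
  have sub: "s \<in> carrier M" if "s \<in> ideal_smult M I N" for s
    using that by induction (auto simp: Nc I.Icarr)
  have smult: "r \<odot>\<^bsub>M\<^esub> s \<in> ideal_smult M I N" if "s \<in> ideal_smult M I N" and r: "r \<in> carrier R" for r s
    using that(1)
  proof induction
    case (prod i x)
    then have "r \<odot>\<^bsub>M\<^esub> (i \<odot>\<^bsub>M\<^esub> x) = (r \<otimes> i) \<odot>\<^bsub>M\<^esub> x" using r Nc I.Icarr by (simp add: smult_assoc1)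
    then show ?case using prod r I.I_l_closed by (simp add: ideal_smult.prod)
  next
    case (sum s t)
    then show ?case using r by (simp add: smult_r_distr sub ideal_smult.sum)
  qed
  obtain x where x: "x \<in> N" using submoduleE(2)[OF N] by blast
  have "\<zero> \<odot>\<^bsub>M\<^esub> x \<in> ideal_smult M I N" using x by (intro ideal_smult.prod) simp_all
  then have zero: "\<zero>\<^bsub>M\<^esub> \<in> ideal_smult M I N" using x Nc by simp
  have "\<ominus>\<^bsub>M\<^esub> s \<in> ideal_smult M I N" if "s \<in> ideal_smult M I N" for s
    using smult[OF that, of "\<ominus> \<one>"] sub[OF that] by (simp add: smult_l_minus)
  then show ?thesis using sub zero smult by (intro submoduleI) (auto intro: ideal_smult.sum)
qed

lemma (in module) colon_submodule:
  assumes I: "ideal I R" and W: "submodule W R M"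
  shows "submodule (colon M W I) R M"
proof (rule submoduleI)
  have Ic: "i \<in> carrier R" if "i \<in> I" for i using ideal.Icarr[OF I that] .
  have zW: "\<zero>\<^bsub>M\<^esub> \<in> W"
    using subgroup.one_closed[OF submodule.axioms(1)[OF W]] by simp
  show "colon M W I \<subseteq> carrier M" by (auto simp: colon_def)
  show "\<zero>\<^bsub>M\<^esub> \<in> colon M W I" using Ic zW by (simp add: colon_def)
  have smult: "r \<odot>\<^bsub>M\<^esub> x \<in> colon M W I" if r: "r \<in> carrier R" and x: "x \<in> colon M W I" for r x
  proof -
    have xc: "x \<in> carrier M" using x by (simp add: colon_def)
    have "i \<odot>\<^bsub>M\<^esub> (r \<odot>\<^bsub>M\<^esub> x) \<in> W" if i: "i \<in> I" for i
    proof -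
      have "i \<odot>\<^bsub>M\<^esub> (r \<odot>\<^bsub>M\<^esub> x) = r \<odot>\<^bsub>M\<^esub> (i \<odot>\<^bsub>M\<^esub> x)"
        using r xc Ic[OF i] by (simp add: smult_assoc1[symmetric] R.m_comm)
      then show ?thesis using submoduleE(4)[OF W r] x i by (simp add: colon_def)
    qed
    then show ?thesis using r xc by (simp add: colon_def)
  qed
  then show "\<And>r x. r \<in> carrier R \<Longrightarrow> x \<in> colon M W I \<Longrightarrow> r \<odot>\<^bsub>M\<^esub> x \<in> colon M W I" .
  show "x \<oplus>\<^bsub>M\<^esub> y \<in> colon M W I" if "x \<in> colon M W I" "y \<in> colon M W I" for x y
    using that Ic submoduleE(5)[OF W] by (simp add: colon_def smult_r_distr)
  show "\<ominus>\<^bsub>M\<^esub> x \<in> colon M W I" if "x \<in> colon M W I" for x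
    using smult[OF _ that, of "\<ominus> \<one>"] that by (simp add: colon_def smult_l_minus)
qed

lemma (in module) ideal_small_iff:
  assumes I: "ideal I R" and N: "submodule N R M"
  shows "ideal_small R I M N \<longleftrightarrow> N = ideal_smult M I (colon M N I)"
proof
  assume "ideal_small R I M N"
  then obtain X' where X': "submodule X' R M" "N = ideal_smult M I X'"
    by (auto simp: ideal_small_def)
  have sub: "X' \<subseteq> colon M N I"
    using submoduleE(1)[OF X'(1)] X'(2) by (auto simp: colon_def intro: ideal_smult.prod)
  have "s \<in> ideal_smult M I (colon M N I)" if "s \<in> ideal_smult M I X'" for s
    using that by induction (use sub in \<open>auto intro: ideal_smult.intros\<close>)
  moreover have "s \<in> N" if "s \<in> ideal_smult M I (colon M N I)" for s
    using that by induction (use submoduleE(5)[OF N] in \<open>auto simp: colon_def\<close>)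
  ultimately show "N = ideal_smult M I (colon M N I)" using X'(2) by blast
next
  assume eq: "N = ideal_smult M I (colon M N I)"
  have "N \<subseteq> colon M N I"
    using submoduleE(1,4)[OF N] ideal.Icarr[OF I] by (auto simp: colon_def)
  then show "ideal_small R I M N"
    unfolding ideal_small_def using eq colon_submodule[OF I N] by blast
qed

end

theory Submission
  imports Defs
begin

text \<open>
  By \<open>quot_map_surj_iff\<close>, \<open>M\<close> is strongly \<open>I\<close>-small iff \<open>(U : I) + M = M : I\<close> forces \<open>U = M\<close> for all
  submodules \<open>U \<subseteq> M\<close>.

  If \<open>M = I (M : I)\<close> and \<open>(U : I) + M = M : I\<close>, then \<open>M = I (U : I) + I M \<subseteq> U + I M\<close>, so smallness
  of \<open>I M\<close> gives \<open>U = M\<close>. Conversely, the submodule \<open>U = I (M : I)\<close> always satisfies the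
  surjectivity condition, because \<open>M : I \<subseteq> U : I\<close>; hence strong \<open>I\<close>-smallness gives
  \<open>M = I (M : I)\<close>.

  The remaining point is that strong \<open>I\<close>-smallness makes \<open>I M\<close> small in \<open>M\<close>. Suppose
  \<open>V + I M = M\<close> with \<open>V \<noteq> M\<close>. As \<open>I\<close> is finitely generated, adding the submodules \<open>a M\<close> to \<open>V\<close>
  one generator \<open>a\<close> at a time reaches \<open>M\<close> after finitely many steps. Stopping just before that
  happens gives a proper submodule \<open>W \<supseteq> V\<close> of \<open>M\<close> and a single \<open>a \<in> I\<close> with \<open>W + a M = M\<close>
  (\<open>proper_submodule_one_generator\<close>): the nonzero module \<open>L = M/W\<close> satisfies \<open>a L = L\<close>. Now let
  \<open>U/W\<close> be the kernel of \<open>a\<close> on \<open>L\<close>. If \<open>I y \<subseteq> M\<close>, then \<open>a y \<equiv> a m\<close> modulo \<open>W\<close> for some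
  \<open>m \<in> M\<close>, and since \<open>a\<close> annihilates \<open>y - m\<close> modulo \<open>W\<close>, so it does all of \<open>I (y - m) \<subseteq> M\<close>;
  that is, \<open>I (y - m) \<subseteq> U\<close>. So \<open>(U : I) + M = M : I\<close> (\<open>colon_kernel_surj\<close>) and therefore \<open>U = M\<close>,
  which means \<open>a L = 0\<close>, contradicting \<open>a L = L \<noteq> 0\<close>.
\<close>

section \<open>Sums and preimages of submodules\<close>

context module
begin

lemma submodule_zero: "submodule W R M \<Longrightarrow> \<zero>\<^bsub>M\<^esub> \<in> W"
  using subgroup.one_closed[OF submodule.axioms(1), of W R M] by simp

lemma mem_set_add_iff: "x \<in> A <+>\<^bsub>M\<^esub> B \<longleftrightarrow> (\<exists>a\<in>A. \<exists>b\<in>B. x = a \<oplus>\<^bsub>M\<^esub> b)"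
  by (auto simp: set_add_def set_mult_def)

lemma set_add_subset:
  assumes N: "submodule N R M" and "A \<subseteq> N" and "B \<subseteq> N"
  shows "A <+>\<^bsub>M\<^esub> B \<subseteq> N"
proof
  fix x assume "x \<in> A <+>\<^bsub>M\<^esub> B"
  then obtain a b where "a \<in> A" "b \<in> B" "x = a \<oplus>\<^bsub>M\<^esub> b" by (auto simp: mem_set_add_iff)
  then show "x \<in> N" using submoduleE(5)[OF N] assms(2,3) by blast
qed

lemma submodule_add_smult_image:
  assumes V: "submodule V R M" and N: "submodule N R M" and a: "a \<in> carrier R"
  shows "submodule (V <+>\<^bsub>M\<^esub> (\<lambda>n. a \<odot>\<^bsub>M\<^esub> n) ` N) R M"
proof (rule submoduleI)
  let ?S = "V <+>\<^bsub>M\<^esub> (\<lambda>n. a \<odot>\<^bsub>M\<^esub> n) ` N"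
  have Vc: "v \<in> carrier M" if "v \<in> V" for v using that submoduleE(1)[OF V] by blast
  have Nc: "n \<in> carrier M" if "n \<in> N" for n using that submoduleE(1)[OF N] by blast
  show sub: "?S \<subseteq> carrier M" using Vc Nc a by (auto simp: mem_set_add_iff)
  have "\<zero>\<^bsub>M\<^esub> = \<zero>\<^bsub>M\<^esub> \<oplus>\<^bsub>M\<^esub> a \<odot>\<^bsub>M\<^esub> \<zero>\<^bsub>M\<^esub>" using a by simp
  then show "\<zero>\<^bsub>M\<^esub> \<in> ?S"
    using submodule_zero[OF V] submodule_zero[OF N] unfolding mem_set_add_iff by blast
  show smult: "r \<odot>\<^bsub>M\<^esub> s \<in> ?S" if r: "r \<in> carrier R" and s: "s \<in> ?S" for r s
  proof -
    obtain v n where vn: "v \<in> V" "n \<in> N" "s = v \<oplus>\<^bsub>M\<^esub> a \<odot>\<^bsub>M\<^esub> n"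
      using s by (auto simp: mem_set_add_iff)
    have "r \<odot>\<^bsub>M\<^esub> (a \<odot>\<^bsub>M\<^esub> n) = a \<odot>\<^bsub>M\<^esub> (r \<odot>\<^bsub>M\<^esub> n)"
      using r a Nc[OF vn(2)] by (simp add: smult_assoc1[symmetric] R.m_comm)
    then have "r \<odot>\<^bsub>M\<^esub> s = r \<odot>\<^bsub>M\<^esub> v \<oplus>\<^bsub>M\<^esub> a \<odot>\<^bsub>M\<^esub> (r \<odot>\<^bsub>M\<^esub> n)"
      using vn r a Vc Nc by (simp add: smult_r_distr)
    then show ?thesis
      using submoduleE(4)[OF V r vn(1)] submoduleE(4)[OF N r vn(2)]
      unfolding mem_set_add_iff by blast
  qed
  show "s \<oplus>\<^bsub>M\<^esub> t \<in> ?S" if s: "s \<in> ?S" and t: "t \<in> ?S" for s t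
  proof -
    obtain v n where vn: "v \<in> V" "n \<in> N" "s = v \<oplus>\<^bsub>M\<^esub> a \<odot>\<^bsub>M\<^esub> n"
      using s by (auto simp: mem_set_add_iff)
    obtain v' n' where vn': "v' \<in> V" "n' \<in> N" "t = v' \<oplus>\<^bsub>M\<^esub> a \<odot>\<^bsub>M\<^esub> n'"
      using t by (auto simp: mem_set_add_iff)
    have "s \<oplus>\<^bsub>M\<^esub> t = (v \<oplus>\<^bsub>M\<^esub> v') \<oplus>\<^bsub>M\<^esub> a \<odot>\<^bsub>M\<^esub> (n \<oplus>\<^bsub>M\<^esub> n')"
      using vn vn' Vc Nc a by (simp add: smult_r_distr M.a_ac)
    then show ?thesis
      using submoduleE(5)[OF V vn(1) vn'(1)] submoduleE(5)[OF N vn(2) vn'(2)]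
      unfolding mem_set_add_iff by blast
  qed
  show "\<ominus>\<^bsub>M\<^esub> s \<in> ?S" if "s \<in> ?S" for s
    using smult[OF _ that, of "\<ominus> \<one>"] sub that by (auto simp: smult_l_minus)
qed

lemma submodule_preimage_smult:
  assumes N: "submodule N R M" and W: "submodule W R M" and a: "a \<in> carrier R"
  shows "submodule {n \<in> N. a \<odot>\<^bsub>M\<^esub> n \<in> W} R M"
proof (rule submoduleI)
  let ?U = "{n \<in> N. a \<odot>\<^bsub>M\<^esub> n \<in> W}"
  have Nc: "n \<in> carrier M" if "n \<in> N" for n using that submoduleE(1)[OF N] by blast
  show "?U \<subseteq> carrier M" using Nc by blast
  show "\<zero>\<^bsub>M\<^esub> \<in> ?U" using submodule_zero[OF N] submodule_zero[OF W] a by simp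
  show smult: "r \<odot>\<^bsub>M\<^esub> n \<in> ?U" if r: "r \<in> carrier R" and n: "n \<in> ?U" for r n
  proof -
    have "a \<odot>\<^bsub>M\<^esub> (r \<odot>\<^bsub>M\<^esub> n) = r \<odot>\<^bsub>M\<^esub> (a \<odot>\<^bsub>M\<^esub> n)"
      using r a Nc n by (simp add: smult_assoc1[symmetric] R.m_comm)
    then show ?thesis using submoduleE(4)[OF N r] submoduleE(4)[OF W r] n by simp
  qed
  show "m \<oplus>\<^bsub>M\<^esub> n \<in> ?U" if "m \<in> ?U" "n \<in> ?U" for m n
    using that submoduleE(5)[OF N] submoduleE(5)[OF W] Nc a by (simp add: smult_r_distr)
  show "\<ominus>\<^bsub>M\<^esub> n \<in> ?U" if "n \<in> ?U" for n
    using smult[OF _ that, of "\<ominus> \<one>"] Nc that by (auto simp: smult_l_minus)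
qed

section \<open>Reduction to one element of the ideal\<close>

text \<open>The last hypothesis says \<open>V + A N \<supseteq> N\<close>, where the submodule generated by \<open>V\<close> and the products
  \<open>a n\<close> is replaced by its universal property. In this form the induction on \<open>A\<close> can absorb
  one generator into \<open>V\<close> without computing with sums over \<open>A\<close>: if \<open>V + a N = N\<close> the search ends
  with \<open>W = V\<close>, and otherwise \<open>V + a N\<close> is again proper.\<close>

lemma proper_submodule_one_generator:
  assumes "finite A" and "A \<subseteq> carrier R" and N: "submodule N R M"
    and "submodule V R M" and "V \<subseteq> N" and "V \<noteq> N"
    and "\<And>W. submodule W R M \<Longrightarrow> V \<subseteq> W \<Longrightarrow> (\<forall>a\<in>A. \<forall>n\<in>N. a \<odot>\<^bsub>M\<^esub> n \<in> W) \<Longrightarrow> N \<subseteq> W"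
  shows "\<exists>a\<in>A. \<exists>W. submodule W R M \<and> W \<subseteq> N \<and> W \<noteq> N \<and> W <+>\<^bsub>M\<^esub> (\<lambda>n. a \<odot>\<^bsub>M\<^esub> n) ` N = N"
  using assms(1,2,4-)
proof (induction A arbitrary: V rule: finite_induct)
  case empty
  then show ?case by blast
next
  case (insert a A)
  let ?V = "V <+>\<^bsub>M\<^esub> (\<lambda>n. a \<odot>\<^bsub>M\<^esub> n) ` N"
  have a: "a \<in> carrier R" using insert.prems by blast
  have V': "submodule ?V R M" by (rule submodule_add_smult_image[OF insert.prems(2) N a])
  have sub: "?V \<subseteq> N"
    using insert.prems(3) submoduleE(4)[OF N a] by (intro set_add_subset[OF N]) auto
  show ?case
  proof (cases "?V = N")
    case True
    then show ?thesis using insert.prems by blast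
  next
    case False
    have Vc: "v \<in> carrier M" if "v \<in> V" for v using that submoduleE(1)[OF insert.prems(2)] by blast
    have Nc: "n \<in> carrier M" if "n \<in> N" for n using that submoduleE(1)[OF N] by blast
    have VV: "V \<subseteq> ?V"
    proof
      fix v assume v: "v \<in> V"
      then have "v = v \<oplus>\<^bsub>M\<^esub> a \<odot>\<^bsub>M\<^esub> \<zero>\<^bsub>M\<^esub>" using a Vc by simp
      then show "v \<in> ?V" using v submodule_zero[OF N] unfolding mem_set_add_iff by blast
    qed
    have aV: "a \<odot>\<^bsub>M\<^esub> n \<in> ?V" if n: "n \<in> N" for n
    proof -
      have "a \<odot>\<^bsub>M\<^esub> n = \<zero>\<^bsub>M\<^esub> \<oplus>\<^bsub>M\<^esub> a \<odot>\<^bsub>M\<^esub> n" using a Nc n by simp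
      then show ?thesis using n submodule_zero[OF insert.prems(2)] unfolding mem_set_add_iff by blast
    qed
    have "N \<subseteq> W" if "submodule W R M" "?V \<subseteq> W" "\<forall>b\<in>A. \<forall>n\<in>N. b \<odot>\<^bsub>M\<^esub> n \<in> W" for W
      using insert.prems(5)[OF that(1)] that(2,3) VV aV by blast
    then show ?thesis using insert.IH[OF _ V' sub False] insert.prems(1) by blast
  qed
qed

lemma genideal_smult_mem:
  assumes A: "A \<subseteq> carrier R" and N: "submodule N R M" and W: "submodule W R M"
    and AW: "\<forall>a\<in>A. \<forall>n\<in>N. a \<odot>\<^bsub>M\<^esub> n \<in> W" and i: "i \<in> Idl A" and n: "n \<in> N"
  shows "i \<odot>\<^bsub>M\<^esub> n \<in> W"
proof -
  let ?J = "{r \<in> carrier R. \<forall>n\<in>N. r \<odot>\<^bsub>M\<^esub> n \<in> W}"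
  have Nc: "n \<in> carrier M" if "n \<in> N" for n using that submoduleE(1)[OF N] by blast
  have l: "r \<otimes> j \<in> ?J" if "j \<in> ?J" "r \<in> carrier R" for r j
    using that Nc submoduleE(4)[OF W] by (simp add: smult_assoc1)
  have neg: "\<ominus> j \<in> ?J" if "j \<in> ?J" for j
    using that Nc submoduleE(3)[OF W] by (simp add: smult_l_minus)
  have "ideal ?J R"
  proof (rule idealI)
    show "subgroup ?J (add_monoid R)"
    proof
      show "?J \<subseteq> carrier (add_monoid R)" by auto
      show "x \<otimes>\<^bsub>add_monoid R\<^esub> y \<in> ?J" if "x \<in> ?J" "y \<in> ?J" for x y
        using that Nc submoduleE(5)[OF W] by (simp add: smult_l_distr)
      show "\<one>\<^bsub>add_monoid R\<^esub> \<in> ?J" using Nc submodule_zero[OF W] by simp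
      show "inv\<^bsub>add_monoid R\<^esub> x \<in> ?J" if "x \<in> ?J" for x
        using neg[OF that] by (simp add: a_inv_def)
    qed
    show "r \<otimes> j \<in> ?J" if "j \<in> ?J" "r \<in> carrier R" for r j by (rule l[OF that])
    then show "j \<otimes> r \<in> ?J" if "j \<in> ?J" "r \<in> carrier R" for r j
      using l[OF that] that by (simp add: R.m_comm)
  qed (rule R.ring_axioms)
  then have "Idl A \<subseteq> ?J" using A AW by (intro R.genideal_minimal) auto
  then show ?thesis using i n by blast
qed

section \<open>The kernel of a surjective multiplication\<close>

text \<open>Everything is read modulo \<open>W\<close>, where \<open>a\<close> maps \<open>N\<close> onto itself: an element \<open>y\<close> with \<open>I y \<subseteq> N\<close> is corrected
  by \<open>n \<in> N\<close> with \<open>a y \<equiv> a n\<close>, and the elements of \<open>I (y - n)\<close> inherit being annihilated by \<open>a\<close>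
  from \<open>y - n\<close>.\<close>

lemma colon_kernel_surj:
  assumes I: "ideal I R" and N: "submodule N R M" and W: "submodule W R M"
    and a: "a \<in> I" and eq: "W <+>\<^bsub>M\<^esub> (\<lambda>n. a \<odot>\<^bsub>M\<^esub> n) ` N = N"
  shows "colon M {n \<in> N. a \<odot>\<^bsub>M\<^esub> n \<in> W} I <+>\<^bsub>M\<^esub> N = colon M N I"
proof
  let ?U = "{n \<in> N. a \<odot>\<^bsub>M\<^esub> n \<in> W}"
  have Ic: "i \<in> carrier R" if "i \<in> I" for i using ideal.Icarr[OF I that] .
  have Nc: "n \<in> carrier M" if "n \<in> N" for n using that submoduleE(1)[OF N] by blast
  have Wc: "w \<in> carrier M" if "w \<in> W" for w using that submoduleE(1)[OF W] by blast
  have NI: "N \<subseteq> colon M N I" using Nc submoduleE(4)[OF N] Ic by (auto simp: colon_def)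
  have "colon M ?U I \<subseteq> colon M N I" by (auto simp: colon_def)
  then show "colon M ?U I <+>\<^bsub>M\<^esub> N \<subseteq> colon M N I"
    using NI by (intro set_add_subset[OF colon_submodule[OF I N]])
  show "colon M N I \<subseteq> colon M ?U I <+>\<^bsub>M\<^esub> N"
  proof
    fix y assume y: "y \<in> colon M N I"
    then have yc: "y \<in> carrier M" by (simp add: colon_def)
    have "a \<odot>\<^bsub>M\<^esub> y \<in> W <+>\<^bsub>M\<^esub> (\<lambda>n. a \<odot>\<^bsub>M\<^esub> n) ` N"
      using y a by (simp add: eq colon_def)
    then obtain w n where wn: "w \<in> W" "n \<in> N" "a \<odot>\<^bsub>M\<^esub> y = w \<oplus>\<^bsub>M\<^esub> a \<odot>\<^bsub>M\<^esub> n"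
      by (auto simp: mem_set_add_iff)
    let ?z = "y \<ominus>\<^bsub>M\<^esub> n"
    have zc: "?z \<in> carrier M" using yc Nc wn by simp
    have "a \<odot>\<^bsub>M\<^esub> ?z = (w \<oplus>\<^bsub>M\<^esub> a \<odot>\<^bsub>M\<^esub> n) \<oplus>\<^bsub>M\<^esub> \<ominus>\<^bsub>M\<^esub> (a \<odot>\<^bsub>M\<^esub> n)"
      using a Ic yc Nc wn by (simp add: a_minus_def smult_r_distr smult_r_minus)
    then have az: "a \<odot>\<^bsub>M\<^esub> ?z = w" using wn Wc Nc a Ic by (simp add: M.a_assoc M.r_neg)
    have zI: "?z \<in> colon M N I"
      using submoduleE(3,5)[OF colon_submodule[OF I N]] y wn(2) NI unfolding a_minus_def by blast
    have "i \<odot>\<^bsub>M\<^esub> ?z \<in> ?U" if i: "i \<in> I" for i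
    proof -
      have "a \<odot>\<^bsub>M\<^esub> (i \<odot>\<^bsub>M\<^esub> ?z) = i \<odot>\<^bsub>M\<^esub> (a \<odot>\<^bsub>M\<^esub> ?z)"
        using i a Ic zc by (simp add: smult_assoc1[symmetric] R.m_comm)
      then show ?thesis
        using zI i submoduleE(4)[OF W Ic[OF i] wn(1)] az by (simp add: colon_def)
    qed
    then have "?z \<in> colon M ?U I" using zc by (simp add: colon_def)
    moreover have "y = ?z \<oplus>\<^bsub>M\<^esub> n" using yc Nc wn by (simp add: a_minus_def M.a_assoc M.l_neg)
    ultimately show "y \<in> colon M ?U I <+>\<^bsub>M\<^esub> N" using wn unfolding mem_set_add_iff by blast
  qed
qed

section \<open>Strong smallness and its two components\<close>

lemma ideal_smult_subset:
  assumes "submodule W R M" and "\<And>i x. i \<in> I \<Longrightarrow> x \<in> N \<Longrightarrow> i \<odot>\<^bsub>M\<^esub> x \<in> W"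
  shows "ideal_smult M I N \<subseteq> W"
proof
  fix s assume "s \<in> ideal_smult M I N"
  then show "s \<in> W" by induction (use assms submoduleE(5) in auto)
qed

lemma strongly_ideal_small_iff_colon:
  assumes "ideal I R" and "submodule N R M"
  shows "strongly_ideal_small R I M N \<longleftrightarrow>
    (\<forall>U. submodule U R M \<and> U \<subseteq> N \<and> colon M U I <+>\<^bsub>M\<^esub> N = colon M N I \<longrightarrow> U = N)"
  unfolding strongly_ideal_small_def
  by (intro all_cong1 imp_cong conj_cong refl quot_map_surj_iff[OF assms(1) _ assms(2)])

lemma strongly_ideal_small_imp_ideal_small:
  assumes I: "ideal I R" and N: "submodule N R M" and S: "strongly_ideal_small R I M N"
  shows "ideal_small R I M N"
proof -
  let ?U = "ideal_smult M I (colon M N I)"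
  have C: "submodule (colon M N I) R M" by (rule colon_submodule[OF I N])
  have U: "submodule ?U R M" by (rule ideal_smult_submodule[OF I C])
  have UN: "?U \<subseteq> N" by (rule ideal_smult_subset[OF N]) (simp add: colon_def)
  have CU: "colon M ?U I = colon M N I"
    using UN by (auto simp: colon_def intro: ideal_smult.prod)
  have NC: "N \<subseteq> colon M N I"
    using submoduleE(1,4)[OF N] ideal.Icarr[OF I] by (auto simp: colon_def)
  have "colon M N I <+>\<^bsub>M\<^esub> N = colon M N I"
  proof
    show "colon M N I <+>\<^bsub>M\<^esub> N \<subseteq> colon M N I"
      by (rule set_add_subset[OF C order.refl NC])
    have "y = y \<oplus>\<^bsub>M\<^esub> \<zero>\<^bsub>M\<^esub>" if "y \<in> colon M N I" for y using that by (simp add: colon_def)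
    then show "colon M N I \<subseteq> colon M N I <+>\<^bsub>M\<^esub> N"
      using submodule_zero[OF N] unfolding mem_set_add_iff subset_iff by blast
  qed
  then have "?U = N"
    using S U UN CU unfolding strongly_ideal_small_iff_colon[OF I N] by simp
  then show ?thesis by (simp add: ideal_small_iff[OF I N])
qed

lemma strongly_ideal_small_imp_small_in:
  assumes A: "finite A" "A \<subseteq> carrier R" and N: "submodule N R M"
    and S: "strongly_ideal_small R (Idl A) M N"
  shows "small_in R M (ideal_smult M (Idl A) N) N"
proof -
  let ?I = "Idl A"
  have I: "ideal ?I R" by (rule R.genideal_ideal[OF A(2)])
  have IN: "ideal_smult M ?I N \<subseteq> N"
    using submoduleE(4)[OF N] ideal.Icarr[OF I] by (intro ideal_smult_subset[OF N]) blast
  have "V = N" if V: "submodule V R M" "V \<subseteq> N" and eq: "V <+>\<^bsub>M\<^esub> ideal_smult M ?I N = N" for V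
  proof (rule ccontr)
    assume ne: "V \<noteq> N"
    have cover: "N \<subseteq> W"
      if W: "submodule W R M" and VW: "V \<subseteq> W" and AW: "\<forall>a\<in>A. \<forall>n\<in>N. a \<odot>\<^bsub>M\<^esub> n \<in> W" for W
    proof -
      have "ideal_smult M ?I N \<subseteq> W"
        using genideal_smult_mem[OF A(2) N W AW] by (intro ideal_smult_subset[OF W])
      then have "V <+>\<^bsub>M\<^esub> ideal_smult M ?I N \<subseteq> W"
        by (rule set_add_subset[OF W VW])
      then show ?thesis using eq by simp
    qed
    obtain a W where a: "a \<in> A" and W: "submodule W R M" "W \<subseteq> N" "W \<noteq> N"
      and sum: "W <+>\<^bsub>M\<^esub> (\<lambda>n. a \<odot>\<^bsub>M\<^esub> n) ` N = N"
      using proper_submodule_one_generator[OF A N V ne cover] by blast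
    let ?U = "{n \<in> N. a \<odot>\<^bsub>M\<^esub> n \<in> W}"
    have aI: "a \<in> ?I" using a R.genideal_self[OF A(2)] by blast
    have "submodule ?U R M" using submodule_preimage_smult[OF N W(1)] a A(2) by blast
    then have "?U = N"
      using S colon_kernel_surj[OF I N W(1) aI sum]
      unfolding strongly_ideal_small_iff_colon[OF I N] by blast
    then have "W <+>\<^bsub>M\<^esub> (\<lambda>n. a \<odot>\<^bsub>M\<^esub> n) ` N \<subseteq> W"
      by (intro set_add_subset[OF W(1)]) auto
    then show False using sum W by blast
  qed
  then show ?thesis using ideal_smult_submodule[OF I N] IN by (simp add: small_in_def)
qed

lemma ideal_small_small_in_imp_strongly:
  assumes I: "ideal I R" and N: "submodule N R M"
    and sm: "ideal_small R I M N" and S: "small_in R M (ideal_smult M I N) N"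
  shows "strongly_ideal_small R I M N"
  unfolding strongly_ideal_small_iff_colon[OF I N]
proof (intro allI impI, elim conjE)
  fix U assume U: "submodule U R M" "U \<subseteq> N" and eq: "colon M U I <+>\<^bsub>M\<^esub> N = colon M N I"
  let ?S = "U <+>\<^bsub>M\<^esub> ideal_smult M I N"
  have P: "submodule (ideal_smult M I N) R M" "ideal_smult M I N \<subseteq> N"
    using S by (auto simp: small_in_def)
  have Ic: "i \<in> carrier R" if "i \<in> I" for i using ideal.Icarr[OF I that] .
  have Nc: "n \<in> carrier M" if "n \<in> N" for n using that submoduleE(1)[OF N] by blast
  have Uc: "u \<in> carrier M" if "u \<in> U" for u using that U Nc by blast
  have Pc: "p \<in> carrier M" if "p \<in> ideal_smult M I N" for p using that P Nc by blast
  have "s \<in> ?S" if "s \<in> ideal_smult M I (colon M N I)" for s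
    using that
  proof induction
    case (prod i x)
    then obtain y n where yn: "y \<in> colon M U I" "n \<in> N" "x = y \<oplus>\<^bsub>M\<^esub> n"
      unfolding eq[symmetric] by (auto simp: mem_set_add_iff)
    have "i \<odot>\<^bsub>M\<^esub> x = i \<odot>\<^bsub>M\<^esub> y \<oplus>\<^bsub>M\<^esub> i \<odot>\<^bsub>M\<^esub> n"
      using yn prod Ic Nc by (simp add: colon_def smult_r_distr)
    moreover have "i \<odot>\<^bsub>M\<^esub> y \<in> U" using yn prod by (simp add: colon_def)
    moreover have "i \<odot>\<^bsub>M\<^esub> n \<in> ideal_smult M I N" using yn prod by (simp add: ideal_smult.prod)
    ultimately show ?case unfolding mem_set_add_iff by blast
  next
    case (sum s t)
    obtain u p where up: "u \<in> U" "p \<in> ideal_smult M I N" "s = u \<oplus>\<^bsub>M\<^esub> p"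
      using sum by (auto simp: mem_set_add_iff)
    obtain u' p' where up': "u' \<in> U" "p' \<in> ideal_smult M I N" "t = u' \<oplus>\<^bsub>M\<^esub> p'"
      using sum by (auto simp: mem_set_add_iff)
    have "s \<oplus>\<^bsub>M\<^esub> t = (u \<oplus>\<^bsub>M\<^esub> u') \<oplus>\<^bsub>M\<^esub> (p \<oplus>\<^bsub>M\<^esub> p')"
      using up up' Uc Pc by (simp add: M.a_ac)
    then show ?case
      using submoduleE(5)[OF U(1) up(1) up'(1)] submoduleE(5)[OF P(1) up(2) up'(2)]
      unfolding mem_set_add_iff by blast
  qed
  then have "N \<subseteq> ?S" using sm ideal_small_iff[OF I N] by blast
  moreover have "?S \<subseteq> N" by (rule set_add_subset[OF N U(2) P(2)])
  ultimately show "U = N" using S U by (auto simp: small_in_def)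
qed

end

theorem mainTheorem4:
  fixes R :: "('a, 'r) ring_scheme" and \<mm> :: "'a set" and I :: "'a set"
    and X :: "('a, 'b, 'm) module_scheme" and M :: "'b set"
  assumes "noetherian_local_ring R \<mm>"
    and "ideal I R"
    and "module R X"
    and "submodule M R X"
  shows "strongly_ideal_small R I X M \<longleftrightarrow>
    ideal_small R I X M \<and> small_in R X (ideal_smult X I M) M"
proof -
  interpret noetherian_local_ring R \<mm> by (rule assms(1))
  interpret X: module R X by (rule assms(3))
  obtain A where A: "A \<subseteq> carrier R" "finite A" "I = Idl\<^bsub>R\<^esub> A"
    using finetely_gen[OF assms(2)] by blast
  show ?thesis
    using X.strongly_ideal_small_imp_ideal_small[OF assms(2,4)]
      X.strongly_ideal_small_imp_small_in[OF A(2,1) assms(4)]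
      X.ideal_small_small_in_imp_strongly[OF assms(2,4)] A(3) by blast
qed

end
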